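(* Let $f: E \to F$ be a $C^1$-smooth surjection between Banach spaces. If the set of critical values of $f$ has cardinality $\leq \mathrm{dens}(F)$, then $f$ is density-surjective; that is, there is a closed linear subspace $G \subset E$ with $\mathrm{dens}(G) = \mathrm{dens}(F)$ such that the restriction $f|_G : G \to F$ is surjective. In particular, this applies when the set of critical values of $f$ is countable.
   Context: The density character $\mathrm{dens}(M)$ of a metric space $M$ is the smallest cardinality of a dense subset of $M$. $C^1$-smooth means continuously (Fréchet) differentiable. Given a differentiable mapping $f: E \to F$ between Banach spaces, a point $x \in E$ is a regular point of $f$ if the differential $Df(x): E \to F$ is surjective; otherwise $x$ is a critical point of $f$. A point $y \in F$ is a regular value of $f$ if $f^{-1}(y)$ contains no critical points; otherwise $y$ is a critical value of $f$. A surjection $f: E \to F$ between Banach spaces is density-surjective if there is a closed linear subspace $G \subset E$ with $\mathrm{dens}(G) = \mathrm{dens}(F)$ such that the restriction $f|_G$ remains surjective onto $F$. *)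

theory Defs
  imports "HOL-Analysis.Analysis"
begin

unbundle cardinal_syntax

definition dense_subset :: "'a::topological_space set \<Rightarrow> 'a set \<Rightarrow> bool"
  where "dense_subset D S \<longleftrightarrow> D \<subseteq> S \<and> S \<subseteq> closure D"

(* Cardinals are represented by well-orders and compared up to order isomorphism
   (=o, \<le>o), so the choice made by SOME is immaterial: see dens_attained, dens_le
   and dens_unique. *)
definition dens :: "'a::metric_space set \<Rightarrow> 'a rel"
  where "dens S =
    (SOME r. \<exists>D. dense_subset D S \<and> r = |D| \<and> (\<forall>D'. dense_subset D' S \<longrightarrow> |D| \<le>o |D'| ))"

lemma dens_exists:
  "\<exists>r D. dense_subset D S \<and> r = |D| \<and> (\<forall>D'. dense_subset D' S \<longrightarrow> |D| \<le>o |D'| )"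
proof -
  let ?R = "{|D| | D. dense_subset D S}"
  have "|S| \<in> ?R"
    using closure_subset by (auto simp: dense_subset_def)
  then obtain r where r: "r \<in> ?R" "\<And>r'. r' <o r \<Longrightarrow> r' \<notin> ?R"
    by (rule wfE_min[OF wf_ordLess]) blast
  then obtain D where D: "dense_subset D S" "r = |D|" by blast
  have "|D| \<le>o |D'|" if "dense_subset D' S" for D'
  proof -
    have "|D'| \<in> ?R" using that by blast
    then have "\<not> |D'| <o |D|" using r(2) D(2) by blast
    then show ?thesis
      using not_ordLess_iff_ordLeq[OF card_of_Well_order card_of_Well_order] by blast
  qed
  with D show ?thesis by blast
qed

lemma dens_spec:
  "\<exists>D. dense_subset D S \<and> dens S = |D| \<and> (\<forall>D'. dense_subset D' S \<longrightarrow> |D| \<le>o |D'| )"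
  unfolding dens_def by (rule someI_ex[OF dens_exists])

lemma dens_attained: "\<exists>D. dense_subset D S \<and> |D| =o dens S"
proof -
  obtain D where D: "dense_subset D S" "dens S = |D|"
    using dens_spec[of S] by blast
  have "|D| =o dens S" unfolding D(2) by (rule card_of_refl)
  with D(1) show ?thesis by blast
qed

lemma dens_le: "dense_subset D S \<Longrightarrow> dens S \<le>o |D|"
proof -
  assume D: "dense_subset D S"
  obtain D0 where D0: "dens S = |D0|" "\<forall>D'. dense_subset D' S \<longrightarrow> |D0| \<le>o |D'|"
    using dens_spec[of S] by blast
  show "dens S \<le>o |D|" unfolding D0(1) using D0(2) D by blast
qed

lemma dens_unique:
  assumes "dense_subset D S" "\<And>D'. dense_subset D' S \<Longrightarrow> |D| \<le>o |D'|"
  shows "dens S =o |D|"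
proof -
  obtain D0 where D0: "dense_subset D0 S" "dens S = |D0|"
    using dens_spec[of S] by blast
  have "|D| \<le>o dens S" unfolding D0(2) by (rule assms(2)[OF D0(1)])
  then show ?thesis using dens_le[OF assms(1)] ordIso_iff_ordLeq by blast
qed

definition C1_smooth :: "('a::real_normed_vector \<Rightarrow> 'b::real_normed_vector) \<Rightarrow> bool"
  where "C1_smooth f \<longleftrightarrow>
    (\<exists>f' :: 'a \<Rightarrow> 'a \<Rightarrow>\<^sub>L 'b.
       (\<forall>x. (f has_derivative blinfun_apply (f' x)) (at x)) \<and> continuous_on UNIV f')"

(* The notions up to critical_value are meaningful only for differentiable f, since
   frechet_derivative is unspecified elsewhere. *)
definition regular_point :: "('a::real_normed_vector \<Rightarrow> 'b::real_normed_vector) \<Rightarrow> 'a \<Rightarrow> bool"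
  where "regular_point f x \<longleftrightarrow> surj (frechet_derivative f (at x))"

abbreviation critical_point :: "('a::real_normed_vector \<Rightarrow> 'b::real_normed_vector) \<Rightarrow> 'a \<Rightarrow> bool"
  where "critical_point f x \<equiv> \<not> regular_point f x"

definition regular_value :: "('a::real_normed_vector \<Rightarrow> 'b::real_normed_vector) \<Rightarrow> 'b \<Rightarrow> bool"
  where "regular_value f y \<longleftrightarrow> \<not> (\<exists>x \<in> f -` {y}. critical_point f x)"

abbreviation critical_value :: "('a::real_normed_vector \<Rightarrow> 'b::real_normed_vector) \<Rightarrow> 'b \<Rightarrow> bool"
  where "critical_value f y \<equiv> \<not> regular_value f y"

definition density_surjective :: "('a::real_normed_vector \<Rightarrow> 'b::real_normed_vector) \<Rightarrow> bool"
  where "density_surjective f \<longleftrightarrow>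
    (\<exists>G. subspace G \<and> closed G \<and> dens G =o dens (UNIV :: 'b set) \<and> f ` G = UNIV)"

end

theory Submission
  imports Defs
begin

text \<open>
  Let \<open>\<kappa> = dens F\<close>, which is infinite unless \<open>F\<close> is trivial, and let \<open>D\<close> be dense in \<open>F\<close> with
  \<open>card D = \<kappa>\<close>. The subspace \<open>G\<close> is the closed linear span of \<open>\<kappa>\<close> many vectors, chosen in
  advance. One preimage of each critical value takes care of those values. There may be more than
  \<open>\<kappa>\<close> regular values, so they must be caught by approximation.

  A regular point \<open>x\<close> comes with quantitative data: an operator \<open>T\<close> (the differential), a constant
  \<open>C\<close> and a radius \<open>r\<close> such that \<open>T u = v\<close> is approximately solvable with \<open>norm u \<le> C * norm v\<close>
  (the Baire category half of the open mapping theorem, \<open>surj_linear_imp_almost_open\<close>), while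
  \<open>f - T\<close> is Lipschitz with a constant much smaller than \<open>1 / C\<close> on the ball of radius \<open>r\<close> about
  \<open>x\<close> (\<open>C1_imp_near_linear\<close>). Such data allow one to solve \<open>f z = y\<close> by Newton iteration with
  frozen differential, started at \<open>x\<close>, as soon as \<open>f x\<close> is close to \<open>y\<close> in terms of \<open>C\<close> and
  \<open>r\<close> alone (\<open>newton_in_subspace\<close>, \<open>submersion_data_imp_hits\<close>). All iterates stay in a closed subspace \<open>G\<close> if \<open>G\<close> contains
  the centre \<open>x\<close> and approximate solutions of \<open>T u = v\<close> for \<open>v\<close> in \<open>D\<close>.

  Hence it suffices to choose, for each \<open>d\<close> in \<open>D\<close> and each pair of values \<open>C = n\<close> and
  \<open>r = 1 / m\<close> with natural \<open>n\<close> and \<open>m\<close>, one centre \<open>x\<close> with \<open>f x\<close> near \<open>d\<close> admitting such data,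
  if there is one, and to put it into \<open>G\<close> together with the approximate solutions for its \<open>T\<close>. If
  \<open>y\<close> is a regular value, any preimage of \<open>y\<close> witnesses that, for suitable \<open>n\<close> and \<open>m\<close>, a choice
  was possible for every \<open>d\<close> close to \<open>y\<close>; the centre chosen for such a \<open>d\<close> may be far from that
  preimage, but Newton iteration from it reaches \<open>y\<close> inside \<open>G\<close>. The density of \<open>G\<close> is exactly
  \<open>\<kappa>\<close>, since the continuous image \<open>F\<close> of \<open>G\<close> cannot have larger density.
\<close>

section \<open>Newton iteration inside a subspace\<close>

text \<open>
  By Baire, the closure of the image of some ball about \<open>0\<close> contains a ball; taking differences
  moves the centre of the latter to \<open>0\<close>, and scaling gives the estimate for all \<open>v\<close>.
\<close>

lemma surj_linear_imp_almost_open: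
  fixes T :: "'a::real_normed_vector \<Rightarrow> 'b::banach"
  assumes "linear T" "surj T"
  shows "\<exists>C>0. \<forall>v. \<forall>\<epsilon>>0. \<exists>u. norm (T u - v) < \<epsilon> \<and> norm u \<le> C * norm v"
proof -
  interpret T: linear T by fact
  define A where "A n = closure (T ` cball 0 (real n))" for n :: nat
  have "(\<Union>n. A n) = UNIV"
  proof -
    have "y \<in> (\<Union>n. A n)" for y
    proof -
      obtain x where x: "y = T x" using \<open>surj T\<close> by (rule surjE)
      obtain n where "norm x \<le> real n" using real_arch_simple by blast
      then have "T x \<in> T ` cball 0 (real n)" by (intro imageI) simp
      then have "T x \<in> A n" unfolding A_def by (rule subsetD[OF closure_subset])
      then show ?thesis using x by blast
    qed
    then show ?thesis by blast
  qed
  then have UN: "interior (\<Union>(range A)) \<noteq> {}" by simp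
  have "\<exists>n. interior (A n) \<noteq> {}"
  proof (rule ccontr)
    assume "\<not> (\<exists>n. interior (A n) \<noteq> {})"
    then have "closedin euclidean S \<and> euclidean interior_of S = {}" if "S \<in> range A" for S
      using that by (auto simp: A_def)
    then have "euclidean interior_of (\<Union>(range A)) = {}"
      by (intro Baire_category_alt disjI1 completely_metrizable_space_euclidean) simp_all
    then show False using UN by simp
  qed
  then obtain n where "interior (A n) \<noteq> {}" by blast
  then obtain z where "z \<in> interior (A n)" by blast
  then obtain \<delta> where \<delta>: "\<delta> > 0" "ball z \<delta> \<subseteq> A n" by (auto simp: mem_interior)
  have small: "\<exists>u. norm (T u - w) < \<epsilon> \<and> norm u \<le> 2 * real n"
    if w: "norm w < \<delta>" and "\<epsilon> > 0" for w \<epsilon>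
  proof -
    have "z + w \<in> A n" "z \<in> A n" using \<delta> w by (auto simp: dist_norm)
    have approx: "\<exists>a. norm a \<le> real n \<and> dist (T a) y < \<epsilon> / 2" if "y \<in> A n" for y
    proof -
      have "y \<in> closure (T ` cball 0 (real n))" "\<epsilon> / 2 > 0"
        using that \<open>\<epsilon> > 0\<close> by (simp_all add: A_def)
      from closure_approachableD[OF this] show ?thesis by (auto simp: dist_commute)
    qed
    obtain a where a: "norm a \<le> real n" "dist (T a) (z + w) < \<epsilon> / 2"
      using approx[OF \<open>z + w \<in> A n\<close>] by blast
    obtain b where b: "norm b \<le> real n" "dist (T b) z < \<epsilon> / 2"
      using approx[OF \<open>z \<in> A n\<close>] by blast
    have eq: "T (a - b) - w = (T a - (z + w)) - (T b - z)" by (simp add: T.diff)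
    have "norm (T (a - b) - w) < \<epsilon>"
      using norm_triangle_ineq4[of "T a - (z + w)" "T b - z"] a(2) b(2)
      unfolding eq dist_norm by linarith
    moreover have "norm (a - b) \<le> 2 * real n"
      using norm_triangle_ineq4[of a b] a b by simp
    ultimately show ?thesis by blast
  qed
  define C where "C = 4 * real n / \<delta> + 1"
  have "\<exists>u. norm (T u - v) < \<epsilon> \<and> norm u \<le> C * norm v" if "\<epsilon> > 0" for v \<epsilon>
  proof (cases "v = 0")
    case True
    then show ?thesis using that by (intro exI[of _ 0]) (simp add: T.zero)
  next
    case False
    define k where "k = 2 * norm v / \<delta>"
    have k: "k > 0" using False \<delta> by (simp add: k_def)
    have "norm (v /\<^sub>R k) < \<delta>" using False \<delta> by (simp add: k_def)
    from small[OF this, of "\<epsilon> / k"] k that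
    obtain u where u: "norm (T u - v /\<^sub>R k) < \<epsilon> / k" "norm u \<le> 2 * real n" by auto
    have "norm (T (k *\<^sub>R u) - v) = k * norm (T u - v /\<^sub>R k)"
    proof -
      have "T (k *\<^sub>R u) - v = k *\<^sub>R (T u - v /\<^sub>R k)"
        using k by (simp add: T.scaleR scaleR_diff_right)
      then show ?thesis using k by simp
    qed
    also have "\<dots> < \<epsilon>" using u k by (simp add: field_simps)
    finally have "norm (T (k *\<^sub>R u) - v) < \<epsilon>" .
    moreover have "norm (k *\<^sub>R u) \<le> C * norm v"
    proof -
      have "norm (k *\<^sub>R u) \<le> k * (2 * real n)" using u k by simp
      also have "\<dots> \<le> C * norm v" by (simp add: k_def C_def algebra_simps)
      finally show ?thesis .
    qed
    ultimately show ?thesis by blast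
  qed
  moreover have "C > 0" using \<delta> by (simp add: C_def add_nonneg_pos)
  ultimately show ?thesis by blast
qed

lemma C1_smooth_imp_continuous_on:
  assumes "C1_smooth f"
  shows "continuous_on UNIV f"
proof -
  obtain f' where "\<And>x. (f has_derivative blinfun_apply (f' x)) (at x)"
    using assms unfolding C1_smooth_def by blast
  then have "isCont f x" for x by (rule has_derivative_continuous)
  then show ?thesis by (simp add: continuous_on_eq_continuous_at)
qed

lemma C1_imp_near_linear:
  fixes f :: "'a::real_normed_vector \<Rightarrow> 'b::real_normed_vector"
    and f' :: "'a \<Rightarrow> 'a \<Rightarrow>\<^sub>L 'b"
  assumes deriv: "\<And>x. (f has_derivative blinfun_apply (f' x)) (at x)"
    and "continuous_on UNIV f'" and "\<epsilon> > 0"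
  shows "\<exists>r>0. \<forall>a\<in>ball x r. \<forall>b\<in>ball x r. norm (f a - f b - f' x (a - b)) \<le> \<epsilon> * norm (a - b)"
proof -
  have "isCont f' x" using assms(2) by (simp add: continuous_on_eq_continuous_at)
  then obtain r where r: "r > 0" "\<And>a. dist a x < r \<Longrightarrow> dist (f' a) (f' x) < \<epsilon>"
    using \<open>\<epsilon> > 0\<close> unfolding continuous_at_eps_delta by blast
  have "norm (f a - f b - f' x (a - b)) \<le> norm (a - b) * \<epsilon>"
    if ab: "a \<in> ball x r" "b \<in> ball x r" for a b
  proof (rule differentiable_bound_linearization[where S = "ball x r" and f' = "\<lambda>x. blinfun_apply (f' x)"])
    show "b + t *\<^sub>R (a - b) \<in> ball x r" if "t \<in> {0..1}" for t :: real
    proof -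
      have "b + t *\<^sub>R (a - b) = (1 - t) *\<^sub>R b + t *\<^sub>R a" by (simp add: algebra_simps)
      then show ?thesis
        using convexD[OF convex_ball, of b x r a "1 - t" t] ab that by simp
    qed
    show "(f has_derivative blinfun_apply (f' a)) (at a within ball x r)" for a
      using deriv has_derivative_at_withinI by blast
    show "onorm (blinfun_apply (f' a) - blinfun_apply (f' x)) \<le> \<epsilon>" if "a \<in> ball x r" for a
    proof -
      have "blinfun_apply (f' a) - blinfun_apply (f' x) = blinfun_apply (f' a - f' x)"
        by (auto simp: blinfun.diff_left)
      then show ?thesis
        using r(2)[of a] that by (simp add: norm_blinfun.rep_eq[symmetric] dist_norm norm_minus_commute)
    qed
    show "x \<in> ball x r" using r by simp
  qed
  then show ?thesis using r(1) by (auto simp: mult.commute)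
qed

text \<open>
  The residual \<open>y - f x\<close> is at least halved by each Newton step: a quarter of it is the error in
  solving the linear equation, another quarter is the nonlinearity of \<open>f\<close>. The steps therefore
  decay geometrically, and their total length is at most \<open>2 * C * norm (y - f x)\<close>.
\<close>

lemma newton_in_subspace:
  fixes f :: "'a::banach \<Rightarrow> 'b::real_normed_vector"
  assumes cont: "continuous_on UNIV f"
    and G: "subspace G" "closed G" "x \<in> G"
    and C: "C > 0"
    and solve: "\<And>w. \<exists>u\<in>G. norm (T u - w) \<le> norm w / 4 \<and> norm u \<le> C * norm w"
    and near: "\<And>a b. a \<in> ball x r \<Longrightarrow> b \<in> ball x r \<Longrightarrow>
                 norm (f a - f b - T (a - b)) \<le> norm (a - b) / (4 * C)"
    and close: "2 * C * norm (y - f x) < r"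
  shows "\<exists>z\<in>G. f z = y"
proof -
  obtain s where s: "\<And>w. s w \<in> G" "\<And>w. norm (T (s w) - w) \<le> norm w / 4"
      "\<And>w. norm (s w) \<le> C * norm w"
    using solve by metis
  define X where "X = rec_nat x (\<lambda>_ z. z + s (y - f z))"
  have X0: "X 0 = x" and XS: "\<And>n. X (Suc n) = X n + s (y - f (X n))"
    by (simp_all add: X_def)
  define e where "e = norm (y - f x)"
  have e: "e \<ge> 0" "2 * C * e < r" using close by (simp_all add: e_def)
  have ball: "a \<in> ball x r" if "norm (a - x) \<le> 2 * C * e * (1 - 1 / 2 ^ n)" for a and n :: nat
  proof -
    have "2 * C * e * (1 - 1 / 2 ^ n) \<le> 2 * C * e" using C e by (simp add: mult_left_le)
    then show ?thesis using that e(2) by (simp add: dist_norm norm_minus_commute)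
  qed
  have inv: "X n \<in> G \<and> norm (y - f (X n)) \<le> e / 2 ^ n
      \<and> norm (X n - x) \<le> 2 * C * e * (1 - 1 / 2 ^ n)" for n
  proof (induction n)
    case 0
    then show ?case using G by (simp add: X0 e_def)
  next
    case (Suc n)
    define w where "w = y - f (X n)"
    have w: "norm w \<le> e / 2 ^ n" using Suc by (simp add: w_def)
    have step: "X (Suc n) = X n + s w" by (simp add: XS w_def)
    have sw: "norm (s w) \<le> C * (e / 2 ^ n)"
      using s(3)[of w] mult_left_mono[OF w, of C] C by linarith
    have "X (Suc n) - x = (X n - x) + s w" by (simp add: step)
    then have "norm (X (Suc n) - x) \<le> norm (X n - x) + norm (s w)"
      using norm_triangle_ineq by metis
    also have "\<dots> \<le> 2 * C * e * (1 - 1 / 2 ^ n) + C * (e / 2 ^ n)" using Suc sw by simp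
    also have "\<dots> = 2 * C * e * (1 - 1 / 2 ^ Suc n)" by (simp add: field_simps)
    finally have dist: "norm (X (Suc n) - x) \<le> 2 * C * e * (1 - 1 / 2 ^ Suc n)" .
    have "norm (f (X (Suc n)) - f (X n) - T (s w)) \<le> norm (s w) / (4 * C)"
      using near[OF ball[OF dist] ball, of "X n" n] Suc step by simp
    also have "\<dots> \<le> (C * norm w) / (4 * C)" using s(3)[of w] C by (intro divide_right_mono) auto
    finally have nl: "norm (f (X (Suc n)) - f (X n) - T (s w)) \<le> norm w / 4" using C by simp
    have "y - f (X (Suc n)) = - (f (X (Suc n)) - f (X n) - T (s w)) - (T (s w) - w)"
      by (simp add: w_def)
    then have "norm (y - f (X (Suc n)))
        \<le> norm (f (X (Suc n)) - f (X n) - T (s w)) + norm (T (s w) - w)"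
      using norm_triangle_ineq4 norm_minus_cancel by metis
    also have "\<dots> \<le> norm w / 2" using nl s(2)[of w] by simp
    also have "\<dots> \<le> e / 2 ^ Suc n" using w by (simp add: field_simps)
    finally show ?case
      using dist Suc s(1) subspace_add[OF G(1)] step by simp
  qed
  have "summable (\<lambda>n. X (Suc n) - X n)"
  proof (rule summable_comparison_test)
    show "\<exists>N. \<forall>n\<ge>N. norm (X (Suc n) - X n) \<le> (C * e) * (1 / 2) ^ n"
    proof (intro exI allI impI)
      fix n
      have "norm (X (Suc n) - X n) \<le> C * norm (y - f (X n))" using s(3) by (simp add: XS)
      also have "\<dots> \<le> C * (e / 2 ^ n)" using inv[of n] C by (intro mult_left_mono) auto
      finally show "norm (X (Suc n) - X n) \<le> (C * e) * (1 / 2) ^ n"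
        by (simp add: power_divide)
    qed
    show "summable (\<lambda>n. (C * e) * (1 / 2) ^ n)"
      by (intro summable_mult summable_geometric) simp
  qed
  then have "(\<lambda>n. \<Sum>k<n. X (Suc k) - X k) \<longlonglongrightarrow> (\<Sum>k. X (Suc k) - X k)"
    by (rule summable_LIMSEQ)
  then have "(\<lambda>n. X n - X 0) \<longlonglongrightarrow> (\<Sum>k. X (Suc k) - X k)"
    by (simp add: sum_lessThan_telescope)
  from tendsto_add[OF this tendsto_const[of "X 0"]]
  obtain z where z: "X \<longlonglongrightarrow> z" by auto
  have "z \<in> G" using closed_sequentially[OF G(2) _ z] inv by blast
  moreover have "(\<lambda>n. f (X n)) \<longlonglongrightarrow> f z"
    using cont z by (simp add: continuous_on_eq_continuous_at isCont_tendsto_compose)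
  moreover have "(\<lambda>n. f (X n)) \<longlonglongrightarrow> y"
  proof -
    have "(\<lambda>n. e * (1 / 2) ^ n) \<longlonglongrightarrow> 0"
      by (intro tendsto_mult_right_zero LIMSEQ_power_zero) simp
    then have "(\<lambda>n. y - f (X n)) \<longlonglongrightarrow> 0"
      by (rule Lim_null_comparison[rotated]) (use inv in \<open>simp add: power_divide\<close>)
    from tendsto_diff[OF tendsto_const[of y] this] show ?thesis by simp
  qed
  ultimately show ?thesis using LIMSEQ_unique by blast
qed

section \<open>Quantitative submersion data\<close>

text \<open>
  The ball is what makes these data useful away from \<open>x\<close>: Newton iteration can be run from \<open>x\<close>
  towards any \<open>y\<close> whose distance to \<open>f x\<close> is small in terms of \<open>C\<close> and \<open>r\<close>, however \<open>x\<close> and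
  \<open>T\<close> were found. Solvability is only approximate because this is what Baire's theorem gives
  directly, and the iteration absorbs the error.
\<close>

definition submersion_data ::
    "('a::real_normed_vector \<Rightarrow> 'b::real_normed_vector) \<Rightarrow> real \<Rightarrow> real \<Rightarrow> 'a \<Rightarrow> ('a \<Rightarrow>\<^sub>L 'b) \<Rightarrow> bool"
  where "submersion_data f C r x T \<longleftrightarrow>
    (\<forall>v. \<forall>\<epsilon>>0. \<exists>u. norm (T u - v) < \<epsilon> \<and> norm u \<le> C * norm v) \<and>
    (\<forall>a\<in>ball x r. \<forall>b\<in>ball x r. norm (f a - f b - T (a - b)) \<le> norm (a - b) / (8 * C))"

lemma regular_point_imp_submersion_data:
  fixes f :: "'a::real_normed_vector \<Rightarrow> 'b::banach"
  assumes "C1_smooth f" "regular_point f x"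
  obtains n m :: nat and T where "n > 0" "m > 0" "submersion_data f (real n) (1 / real m) x T"
proof -
  obtain f' :: "'a \<Rightarrow> 'a \<Rightarrow>\<^sub>L 'b"
    where f': "\<And>x. (f has_derivative blinfun_apply (f' x)) (at x)" "continuous_on UNIV f'"
    using assms(1) unfolding C1_smooth_def by blast
  have "surj (blinfun_apply (f' x))"
    using assms(2) frechet_derivative_at[OF f'(1)] by (simp add: regular_point_def)
  from surj_linear_imp_almost_open[OF bounded_linear.linear[OF blinfun.bounded_linear_right] this]
  obtain C where C: "C > 0"
      "\<forall>v. \<forall>\<epsilon>>0. \<exists>u. norm (f' x u - v) < \<epsilon> \<and> norm u \<le> C * norm v"
    by (elim exE conjE)
  obtain n :: nat where n: "C \<le> real n" using real_arch_simple by blast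
  then have n0: "n > 0" using C(1) by (cases n) auto
  then have "1 / (8 * real n) > 0" by simp
  from C1_imp_near_linear[OF f' this]
  obtain r where r: "r > 0" "\<forall>a\<in>ball x r. \<forall>b\<in>ball x r.
      norm (f a - f b - f' x (a - b)) \<le> 1 / (8 * real n) * norm (a - b)"
    by blast
  obtain k where k: "1 / real (Suc k) < r" using r(1) by (rule nat_approx_posE)
  define m where "m = Suc k"
  have m: "m > 0" "1 / real m < r" using k by (simp_all only: m_def zero_less_Suc)
  have "submersion_data f (real n) (1 / real m) x (f' x)"
    unfolding submersion_data_def
  proof (intro conjI allI impI ballI)
    fix v :: 'b and \<epsilon> :: real assume "\<epsilon> > 0"
    then obtain u where "norm (f' x u - v) < \<epsilon>" "norm u \<le> C * norm v"
      using C(2) by blast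
    moreover have "C * norm v \<le> real n * norm v" using n by (simp add: mult_right_mono)
    ultimately show "\<exists>u. norm (f' x u - v) < \<epsilon> \<and> norm u \<le> real n * norm v"
      by (meson order_trans)
  next
    fix a b assume "a \<in> ball x (1 / real m)" "b \<in> ball x (1 / real m)"
    then have "a \<in> ball x r" "b \<in> ball x r" using m(2) by simp_all
    then show "norm (f a - f b - f' x (a - b)) \<le> norm (a - b) / (8 * real n)"
      using r(2) by fastforce
  qed
  then show thesis by (rule that[OF n0 m(1)])
qed

text \<open>
  To run Newton iteration in \<open>G\<close> it is enough that \<open>G\<close> solves \<open>T u = v\<close> up to a relative error
  for \<open>v\<close> in a dense set; replacing \<open>w\<close> by a nearby \<open>v\<close> at most doubles the constant \<open>C\<close>.
\<close>

lemma submersion_data_imp_hits: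
  fixes f :: "'a::banach \<Rightarrow> 'b::real_normed_vector"
  assumes cont: "continuous_on UNIV f"
    and G: "subspace G" "closed G" "x \<in> G"
    and C: "C > 0" and data: "submersion_data f C r x T"
    and D: "closure D = UNIV"
    and solve: "\<And>v. v \<in> D \<Longrightarrow> \<exists>u\<in>G. norm (T u - v) \<le> norm v / 8 \<and> norm u \<le> C * norm v"
    and close: "4 * C * norm (y - f x) < r"
  shows "\<exists>z\<in>G. f z = y"
proof (rule newton_in_subspace[where C = "2 * C" and T = "blinfun_apply T", OF cont G])
  show "2 * C > 0" "2 * (2 * C) * norm (y - f x) < r" using C close by simp_all
  show "norm (f a - f b - T (a - b)) \<le> norm (a - b) / (4 * (2 * C))"
    if "a \<in> ball x r" "b \<in> ball x r" for a b
    using data that by (simp add: submersion_data_def)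
  show "\<exists>u\<in>G. norm (T u - w) \<le> norm w / 4 \<and> norm u \<le> 2 * C * norm w" for w
  proof (cases "w = 0")
    case True
    then show ?thesis using subspace_0[OF G(1)] by (intro bexI[of _ 0]) auto
  next
    case False
    then have "norm w / 16 > 0" by simp
    moreover have "w \<in> closure D" using D by simp
    ultimately obtain v where v: "v \<in> D" "norm (v - w) < norm w / 16"
      unfolding closure_approachable dist_norm by blast
    obtain u where u: "u \<in> G" "norm (T u - v) \<le> norm v / 8" "norm u \<le> C * norm v"
      using solve[OF v(1)] by blast
    have nv: "norm v \<le> norm w + norm w / 16"
      using v(2) norm_triangle_sub[of v w] by linarith
    have "norm (T u - w) \<le> norm (T u - v) + norm (v - w)"
      using norm_triangle_ineq[of "T u - v" "v - w"] by simp
    then have "norm (T u - w) \<le> norm w / 4" using u(2) v(2) nv norm_ge_zero[of w] by linarith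
    moreover have "norm v \<le> 2 * norm w" using nv norm_ge_zero[of w] by linarith
    then have "C * norm v \<le> C * (2 * norm w)" using C by (simp add: mult_left_mono)
    then have "norm u \<le> 2 * C * norm w" using u(3) by (simp add: algebra_simps)
    ultimately show ?thesis using u(1) by blast
  qed
qed

section \<open>Density characters\<close>

lemma card_Times_le_infinite:
  assumes "infinite D" "|A| \<le>o |D|" "|B| \<le>o |D|"
  shows "|A \<times> B| \<le>o |D|"
  using card_of_Times_ordLeq_infinite_Field[of "|D|" A B] assms
  by (simp add: Field_card_of card_of_card_order_on)

lemma card_Un_le_infinite:
  assumes "infinite D" "|A| \<le>o |D|" "|B| \<le>o |D|"
  shows "|A \<union> B| \<le>o |D|"
  using card_of_Un_ordLeq_infinite_Field[of "|D|" A B] assms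
  by (simp add: Field_card_of card_of_card_order_on)

lemma card_countable_le_infinite:
  assumes "infinite D" "countable A"
  shows "|A| \<le>o |D|"
proof -
  have "|A| \<le>o |UNIV :: nat set|"
    using assms(2) unfolding countable_def card_of_ordLeq[symmetric] by auto
  also have "|UNIV :: nat set| \<le>o |D|" using assms(1) infinite_iff_card_of_nat by blast
  finally show ?thesis .
qed

lemma card_image_le_infinite:
  assumes "|A| \<le>o |D|"
  shows "|h ` A| \<le>o |D|"
  using card_of_image assms ordLeq_transitive by blast

lemma subspace_closure_if_rational_subspace:
  fixes S :: "'a::real_normed_vector set"
  assumes "0 \<in> S" and comb: "\<And>a b q. a \<in> S \<Longrightarrow> b \<in> S \<Longrightarrow> q \<in> \<rat> \<Longrightarrow> a + q *\<^sub>R b \<in> S"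
  shows "subspace (closure S)"
  unfolding subspace_def
proof (intro conjI ballI allI)
  show "0 \<in> closure S" using assms(1) closure_subset by blast
  show "x + y \<in> closure S" if xy: "x \<in> closure S" "y \<in> closure S" for x y
  proof -
    obtain X where X: "\<And>n. X n \<in> S" "X \<longlonglongrightarrow> x"
      using xy(1) unfolding closure_sequential by blast
    obtain Y where Y: "\<And>n. Y n \<in> S" "Y \<longlonglongrightarrow> y"
      using xy(2) unfolding closure_sequential by blast
    have "X n + Y n \<in> S" for n using comb[of "X n" "Y n" 1] X Y by simp
    moreover have "(\<lambda>n. X n + Y n) \<longlonglongrightarrow> x + y" using X Y by (intro tendsto_add)
    ultimately show ?thesis
      unfolding closure_sequential by (intro exI[of _ "\<lambda>n. X n + Y n"]) simp
  qed
  show "c *\<^sub>R x \<in> closure S" if x: "x \<in> closure S" for c x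
  proof -
    obtain X where X: "\<And>n. X n \<in> S" "X \<longlonglongrightarrow> x"
      using x unfolding closure_sequential by blast
    have "c \<in> closure \<rat>" by (simp add: Rats_closure_real)
    then obtain q where q: "\<And>n. q n \<in> \<rat>" "q \<longlonglongrightarrow> c"
      unfolding closure_sequential by blast
    have "q n *\<^sub>R X n \<in> S" for n using comb[of 0 "X n" "q n"] assms(1) X q by simp
    moreover have "(\<lambda>n. q n *\<^sub>R X n) \<longlonglongrightarrow> c *\<^sub>R x" using X q by (intro tendsto_scaleR)
    ultimately show ?thesis
      unfolding closure_sequential by (intro exI[of _ "\<lambda>n. q n *\<^sub>R X n"]) simp
  qed
qed

text \<open>
  The closed span of \<open>X\<close> is the closure of the rational span, which is built from \<open>X\<close> in
  countably many rounds, none of which raises an infinite cardinality.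
\<close>

lemma closed_subspace_dens_le:
  fixes X :: "'a::real_normed_vector set"
  assumes D: "infinite D" and X: "|X| \<le>o |D|"
  obtains G where "subspace G" "closed G" "X \<subseteq> G" "dens G \<le>o |D|"
proof -
  define S where "S = rec_nat (insert 0 X) (\<lambda>_ A. (\<lambda>((a, b), q). a + q *\<^sub>R b) ` ((A \<times> A) \<times> \<rat>))"
  have S0: "S 0 = insert 0 X"
    and SS: "\<And>n. S (Suc n) = (\<lambda>((a, b), q). a + q *\<^sub>R b) ` ((S n \<times> S n) \<times> \<rat>)"
    by (simp_all add: S_def)
  have comb: "a + q *\<^sub>R b \<in> S (Suc n)" if "a \<in> S n" "b \<in> S n" "q \<in> \<rat>" for a b q n
    unfolding SS using that by (intro image_eqI[of _ _ "((a, b), q)"]) auto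
  have "S n \<subseteq> S (Suc n)" for n
    using comb[of _ n _ 0] by auto
  then have mono: "S m \<subseteq> S n" if "m \<le> n" for m n
    using that by (rule lift_Suc_mono_le)
  define U where "U = (\<Union>n. S n)"
  have "|S n| \<le>o |D|" for n
  proof (induction n)
    case 0
    have "|{0} \<union> X| \<le>o |D|"
      by (intro card_Un_le_infinite card_countable_le_infinite D X) simp
    then show ?case by (simp add: S0)
  next
    case (Suc n)
    then show ?case unfolding SS
      by (intro card_image_le_infinite card_Times_le_infinite D
          card_countable_le_infinite[OF D countable_rat])
  qed
  then have "|U| \<le>o |D|"
    unfolding U_def using card_countable_le_infinite[OF D, of "UNIV :: nat set"]
    by (intro card_of_UNION_ordLeq_infinite D) auto
  moreover have "dens (closure U) \<le>o |U|"
    by (rule dens_le) (simp add: dense_subset_def closure_subset)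
  ultimately have "dens (closure U) \<le>o |D|" using ordLeq_transitive by blast
  moreover have "subspace (closure U)"
  proof (rule subspace_closure_if_rational_subspace)
    show "0 \<in> U" using S0 unfolding U_def by auto
    fix a b and q :: real assume "a \<in> U" "b \<in> U" "q \<in> \<rat>"
    then obtain i j where "a \<in> S i" "b \<in> S j" unfolding U_def by blast
    then have "a \<in> S (max i j)" "b \<in> S (max i j)" using mono by (meson max.cobounded1 max.cobounded2 subsetD)+
    then show "a + q *\<^sub>R b \<in> U" using comb \<open>q \<in> \<rat>\<close> unfolding U_def by blast
  qed
  moreover have "X \<subseteq> closure U"
    using S0 closure_subset[of U] unfolding U_def by blast
  ultimately show thesis using that closed_closure by blast
qed

text \<open>A continuous surjection maps dense sets to dense sets.\<close>

lemma dens_le_of_continuous_image: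
  fixes f :: "'a::metric_space \<Rightarrow> 'b::metric_space"
  assumes cont: "continuous_on UNIV f" and img: "f ` G = UNIV"
  shows "dens (UNIV :: 'b set) \<le>o dens G"
proof -
  obtain D where D: "dense_subset D G" "|D| =o dens G" using dens_attained by blast
  have "UNIV \<subseteq> f ` closure D" using img D(1) unfolding dense_subset_def by blast
  also have "\<dots> \<subseteq> closure (f ` D)"
    by (rule image_closure_subset[OF continuous_on_subset[OF cont]]) (auto simp: closure_subset)
  finally have "dense_subset (f ` D) (UNIV :: 'b set)" by (simp add: dense_subset_def)
  then have "dens (UNIV :: 'b set) \<le>o |f ` D|" by (rule dens_le)
  also have "|f ` D| \<le>o |D|" by (rule card_of_image)
  also note D(2)
  finally show ?thesis .
qed

lemma dense_imp_infinite:
  fixes D :: "'b::real_normed_vector set"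
  assumes "closure D = UNIV" "v \<noteq> (0 :: 'b)"
  shows "infinite D"
proof
  assume "finite D"
  then have "closed D" by (rule finite_imp_closed)
  then have "finite (UNIV :: 'b set)" using assms(1) \<open>finite D\<close> by (simp add: closure_closed)
  then have "finite (range (\<lambda>t :: real. t *\<^sub>R v))"
    by (rule finite_subset[OF subset_UNIV])
  moreover have "inj (\<lambda>t :: real. t *\<^sub>R v)" using assms(2) by (auto simp: inj_on_def)
  ultimately show False using finite_imageD infinite_UNIV_char_0 by blast
qed

section \<open>Construction of the subspace\<close>

lemma exists_small_subspace_onto:
  fixes f :: "'a::banach \<Rightarrow> 'b::banach"
  assumes C1: "C1_smooth f" and surj: "surj f"
    and D: "infinite D" "closure D = (UNIV :: 'b set)"
    and crit: "|{y. critical_value f y}| \<le>o |D|"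
  obtains G where "subspace G" "closed G" "dens G \<le>o |D|" "f ` G = UNIV"
proof -
  have cont: "continuous_on UNIV f" using C1 by (rule C1_smooth_imp_continuous_on)
  \<comment> \<open>The tolerance \<open>1 / (16 * n * m)\<close> is such that twice its value is still allowed in
    \<open>submersion_data_imp_hits\<close> for \<open>C = n\<close> and \<open>r = 1 / m\<close>.\<close>
  define P where "P = (\<lambda>(d, n, m) (x, T).
    norm (f x - d) < 1 / (16 * real n * real m) \<and> submersion_data f (real n) (1 / real m) x T)"
  define ctr where "ctr i = (SOME p. P i p)" for i
  define sol where "sol = (\<lambda>((d, n, m), v). SOME u.
    norm (snd (ctr (d, n, m)) u - v) \<le> norm v / 8 \<and> norm u \<le> real (n :: nat) * norm v)"
  define I where "I = D \<times> (UNIV :: nat set) \<times> (UNIV :: nat set)"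
  define X where "X = (fst \<circ> ctr) ` I \<union> sol ` (I \<times> D) \<union> inv f ` {y. critical_value f y}"
  have I: "|I| \<le>o |D|"
    unfolding I_def
    by (intro card_Times_le_infinite D card_of_refl[THEN ordIso_imp_ordLeq]
        card_countable_le_infinite[OF D(1), of "UNIV :: nat set"]) simp_all
  have "|X| \<le>o |D|"
    unfolding X_def
    by (intro card_Un_le_infinite card_image_le_infinite card_Times_le_infinite I crit D
        card_of_refl[THEN ordIso_imp_ordLeq])
  then obtain G where G: "subspace G" "closed G" "X \<subseteq> G" "dens G \<le>o |D|"
    using closed_subspace_dens_le[OF D(1)] by blast
  have "y \<in> f ` G" for y
  proof (cases "critical_value f y")
    case True
    then have "inv f y \<in> X" unfolding X_def by simp
    then have "inv f y \<in> G" using G(3) by (rule subsetD[rotated])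
    then have "f (inv f y) \<in> f ` G" by (rule imageI)
    then show ?thesis by (simp only: surj_f_inv_f[OF surj])
  next
    case False
    obtain x0 where x0: "f x0 = y" using surj by (metis surjD)
    then have "regular_point f x0" using False by (auto simp: regular_value_def)
    then obtain n m :: nat and T0 where nm: "n > 0" "m > 0"
      and T0: "submersion_data f (real n) (1 / real m) x0 T0"
      by (rule regular_point_imp_submersion_data[OF C1])
    define \<delta> where "\<delta> = 1 / (16 * real n * real m)"
    have "\<delta> > 0" using nm by (simp add: \<delta>_def)
    moreover have "y \<in> closure D" using D(2) by simp
    ultimately obtain d where d: "d \<in> D" "norm (d - y) < \<delta>"
      unfolding closure_approachable dist_norm by blast
    have "P (d, n, m) (x0, T0)"
      using d(2) T0 x0 unfolding P_def \<delta>_def by (simp add: norm_minus_commute)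
    then have ctr: "P (d, n, m) (ctr (d, n, m))" unfolding ctr_def by (rule someI)
    obtain x T where xT: "ctr (d, n, m) = (x, T)" by (cases "ctr (d, n, m)")
    have x: "norm (f x - d) < \<delta>" "submersion_data f (real n) (1 / real m) x T"
      using ctr unfolding xT P_def \<delta>_def by auto
    have i: "(d, n, m) \<in> I" using d unfolding I_def by simp
    have "(fst \<circ> ctr) (d, n, m) \<in> X" unfolding X_def by (intro UnI1 imageI i)
    then have xG: "x \<in> G" using G(3) by (auto simp: xT)
    have "\<exists>z\<in>G. f z = y"
    proof (rule submersion_data_imp_hits[OF cont G(1,2) xG _ x(2) D(2)])
      show "0 < real n" using nm by simp
      show "\<exists>u\<in>G. norm (T u - v) \<le> norm v / 8 \<and> norm u \<le> real n * norm v" if "v \<in> D" for v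
      proof -
        have "\<exists>u. norm (T u - v) \<le> norm v / 8 \<and> norm u \<le> real n * norm v"
        proof (cases "v = 0")
          case True
          then show ?thesis by (intro exI[of _ 0]) simp
        next
          case False
          then have "norm v / 8 > 0" by simp
          then obtain u where "norm (T u - v) < norm v / 8" "norm u \<le> real n * norm v"
            using x(2) unfolding submersion_data_def by blast
          then show ?thesis by (intro exI[of _ u]) simp
        qed
        then have "norm (T (sol ((d, n, m), v)) - v) \<le> norm v / 8
            \<and> norm (sol ((d, n, m), v)) \<le> real n * norm v"
          unfolding sol_def by (simp add: xT) (rule someI_ex)
        moreover have "sol ((d, n, m), v) \<in> X"
          unfolding X_def by (intro UnI1 UnI2 imageI SigmaI i that)
        then have "sol ((d, n, m), v) \<in> G" using G(3) by (rule subsetD[rotated])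
        ultimately show ?thesis by (rule rev_bexI[rotated])
      qed
      have "norm (y - f x) \<le> norm (d - y) + norm (f x - d)"
        using norm_triangle_ineq4[of "y - d" "f x - d"] by (simp add: norm_minus_commute)
      then have "norm (y - f x) < 2 * \<delta>" using d x by simp
      then have "4 * real n * norm (y - f x) < 4 * real n * (2 * \<delta>)" using nm by simp
      also have "\<dots> \<le> 1 / real m" using nm by (simp add: \<delta>_def field_simps)
      finally show "4 * real n * norm (y - f x) < 1 / real m" .
    qed
    then show ?thesis by blast
  qed
  then have "f ` G = UNIV" by blast
  then show thesis by (rule that[OF G(1,2,4)])
qed

theorem corollary4:
  fixes f :: "'a::banach \<Rightarrow> 'b::banach"
  assumes "C1_smooth f" and "surj f"
  shows "( |{y. critical_value f y}| \<le>o dens (UNIV :: 'b set) \<longrightarrow> density_surjective f) \<and>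
         (countable {y. critical_value f y} \<longrightarrow> density_surjective f)"
proof -
  have cont: "continuous_on UNIV f" using assms(1) by (rule C1_smooth_imp_continuous_on)
  obtain D where D: "closure D = (UNIV :: 'b set)" "|D| =o dens (UNIV :: 'b set)"
    using dens_attained[of "UNIV :: 'b set"] unfolding dense_subset_def by blast
  have onto_dens: "density_surjective f"
    if G: "subspace G" "closed G" "dens G \<le>o |D|" "f ` G = UNIV" for G
  proof -
    have "dens G \<le>o dens (UNIV :: 'b set)" using G(3) D(2) ordLeq_ordIso_trans by blast
    then have "dens G =o dens (UNIV :: 'b set)"
      using dens_le_of_continuous_image[OF cont G(4)] ordIso_iff_ordLeq by blast
    then show ?thesis using G unfolding density_surjective_def by blast
  qed
  show ?thesis
  proof (cases "\<exists>v :: 'b. v \<noteq> 0")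
    case True
    then have inf: "infinite D" using dense_imp_infinite[OF D(1)] by blast
    have main: "density_surjective f" if "|{y. critical_value f y}| \<le>o |D|"
      using exists_small_subspace_onto[OF assms inf D(1) that] onto_dens by metis
    show ?thesis
      using main card_countable_le_infinite[OF inf] ordLeq_ordIso_trans ordIso_symmetric[OF D(2)]
      by blast
  next
    \<comment> \<open>If \<open>F\<close> is trivial then its density character is \<open>1\<close>, and \<open>G = {0}\<close> works.\<close>
    case False
    have "D \<noteq> {}" using D(1) by auto
    then have "|{0 :: 'a}| \<le>o |D|" by (rule card_of_singl_ordLeq)
    moreover have "dens {0 :: 'a} \<le>o |{0 :: 'a}|"
      by (rule dens_le) (simp add: dense_subset_def)
    ultimately have "dens {0 :: 'a} \<le>o |D|" using ordLeq_transitive by blast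
    moreover have "f ` {0} = UNIV"
    proof -
      have "y = f 0" for y using False by metis
      then show ?thesis by blast
    qed
    ultimately have "density_surjective f" by (intro onto_dens[of "{0}"]) auto
    then show ?thesis by blast
  qed
qed

end
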